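(* Assume Conjecture (T) (stated in the context). Then there is a computable function $B$ which assigns to every polynomial $D(x_1,\ldots,x_p)$ with integer coefficients (for arbitrary $p\ge 1$) a non-negative integer $B(D)$ such that: whenever the equation $D(x_1,\ldots,x_p)=0$ has only finitely many rational solutions, the heights of all these rational solutions are at most $B(D)$.
   Context: For a positive integer $n$, let $E_n=\{x_i=1,\ x_i+x_j=x_k,\ x_i\cdot x_j=x_k:\ i,j,k\in\{1,\ldots,n\}\}$ be the set of all formal equations of these forms in the variables $x_1,\ldots,x_n$ (indices may coincide). A system $S\subseteq E_n$ is solved by a tuple if the tuple satisfies every equation in $S$. Conjecture (T) is the statement: for each positive integer $n$, if a system $S\subseteq E_n$ has only finitely many solutions in integers $x_1,\ldots,x_n$, then each such solution satisfies $|x_1|,\ldots,|x_n|\le 2^{2^{n-1}}$. The height of a rational number $y/z$ written in lowest terms ($y,z$ coprime integers, $z>0$) is $\max(|y|,z)$; the height of a rational tuple is the maximum of the heights of its coordinates. Polynomials are given to algorithms through a standard effective encoding (number of variables and list of coefficients). *)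

theory Defs
  imports Complex_Main "HOL-Library.FuncSet" "HOL-Library.Poly_Mapping"
    "HOL-Library.Nat_Bijection"
begin

text \<open>Throughout, an \<open>n\<close>-tuple over a set is an element of \<open>{1..n} \<rightarrow>\<^sub>E A\<close>, so that
  finiteness of a set of solutions is finiteness of a set of genuine tuples.\<close>

subsection \<open>Systems of elementary equations\<close>

datatype equation =
    One nat              \<comment> \<open>\<open>x\<^sub>i = 1\<close>\<close>
  | Add nat nat nat      \<comment> \<open>\<open>x\<^sub>i + x\<^sub>j = x\<^sub>k\<close>\<close>
  | Mult nat nat nat     \<comment> \<open>\<open>x\<^sub>i \<cdot> x\<^sub>j = x\<^sub>k\<close>\<close>

definition E :: "nat \<Rightarrow> equation set" where
  "E n = {One i | i. i \<in> {1..n}}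
       \<union> {Add i j k | i j k. i \<in> {1..n} \<and> j \<in> {1..n} \<and> k \<in> {1..n}}
       \<union> {Mult i j k | i j k. i \<in> {1..n} \<and> j \<in> {1..n} \<and> k \<in> {1..n}}"

fun satisfies :: "(nat \<Rightarrow> int) \<Rightarrow> equation \<Rightarrow> bool" where
  "satisfies x (One i) \<longleftrightarrow> x i = 1"
| "satisfies x (Add i j k) \<longleftrightarrow> x i + x j = x k"
| "satisfies x (Mult i j k) \<longleftrightarrow> x i * x j = x k"

definition int_solutions :: "nat \<Rightarrow> equation set \<Rightarrow> (nat \<Rightarrow> int) set" where
  "int_solutions n S = {x \<in> {1..n} \<rightarrow>\<^sub>E UNIV. \<forall>e \<in> S. satisfies x e}"

definition conjecture_T :: bool where
  "conjecture_T \<longleftrightarrow>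
     (\<forall>n \<ge> 1. \<forall>S \<subseteq> E n. finite (int_solutions n S) \<longrightarrow>
        (\<forall>x \<in> int_solutions n S. \<forall>i \<in> {1..n}. \<bar>x i\<bar> \<le> 2 ^ (2 ^ (n - 1))))"

subsection \<open>Polynomials with integer coefficients and their rational zeros\<close>

text \<open>A polynomial maps monomials (finitely supported exponent functions on the variable
  indices) to coefficients.\<close>

type_synonym int_mpoly = "(nat \<Rightarrow>\<^sub>0 nat) \<Rightarrow>\<^sub>0 int"

definition polys :: "nat \<Rightarrow> int_mpoly set" where
  "polys p = {D. \<forall>m \<in> Poly_Mapping.keys D. Poly_Mapping.keys m \<subseteq> {1..p}}"

definition eval_mpoly :: "int_mpoly \<Rightarrow> (nat \<Rightarrow> rat) \<Rightarrow> rat" where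
  "eval_mpoly D x =
     (\<Sum>m \<in> Poly_Mapping.keys D. of_int (Poly_Mapping.lookup D m) *
        (\<Prod>i \<in> Poly_Mapping.keys m. x i ^ Poly_Mapping.lookup m i))"

definition rat_solutions :: "nat \<Rightarrow> int_mpoly \<Rightarrow> (nat \<Rightarrow> rat) set" where
  "rat_solutions p D = {x \<in> {1..p} \<rightarrow>\<^sub>E UNIV. eval_mpoly D x = 0}"

definition height :: "rat \<Rightarrow> int" where
  "height r = (case quotient_of r of (y, z) \<Rightarrow> max \<bar>y\<bar> z)"

definition tuple_height :: "nat \<Rightarrow> (nat \<Rightarrow> rat) \<Rightarrow> int" where
  "tuple_height p x = Max ((\<lambda>i. height (x i)) ` {1..p})"

subsection \<open>Encoding of polynomials\<close>

definition max_degree :: "int_mpoly \<Rightarrow> nat" where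
  "max_degree D =
     Max (insert 0 (\<Union>m \<in> Poly_Mapping.keys D. Poly_Mapping.lookup m ` Poly_Mapping.keys m))"

text \<open>If every variable occurs with degree at most \<open>d\<close>, the possible monomials in
  \<open>x\<^sub>1, \<dots>, x\<^sub>p\<close> are numbered \<open>0, \<dots>, (d + 1)\<^sup>p - 1\<close>, the exponents being the digits of
  the number in base \<open>d + 1\<close>.\<close>

definition nth_monomial :: "nat \<Rightarrow> nat \<Rightarrow> nat \<Rightarrow> (nat \<Rightarrow>\<^sub>0 nat)" where
  "nth_monomial p d k =
     (\<Sum>i = 1..p. Poly_Mapping.single i ((k div (d + 1) ^ (i - 1)) mod (d + 1)))"

definition coeff_list :: "nat \<Rightarrow> int_mpoly \<Rightarrow> int list" where
  "coeff_list p D =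
     map (\<lambda>k. Poly_Mapping.lookup D (nth_monomial p (max_degree D) k))
       [0..<(max_degree D + 1) ^ p]"

text \<open>The degree need not be recorded: for \<open>p \<ge> 1\<close> it is determined by \<open>p\<close> and the
  length of the list of coefficients.\<close>

definition poly_code :: "nat \<Rightarrow> int_mpoly \<Rightarrow> nat" where
  "poly_code p D = prod_encode (p, list_encode (map int_encode (coeff_list p D)))"

lemma lookup_nth_monomial:
  "Poly_Mapping.lookup (nth_monomial p d k) i =
     (if i \<in> {1..p} then (k div (d + 1) ^ (i - 1)) mod (d + 1) else 0)"
  by (auto simp: nth_monomial_def lookup_sum lookup_single when_def)

lemma digits_exist:
  fixes b :: nat assumes "\<And>i. i < p \<Longrightarrow> a i < b"
  shows "\<exists>k < b ^ p. \<forall>i < p. (k div b ^ i) mod b = a i"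
  using assms
proof (induction p)
  case (Suc p)
  then obtain k where k: "k < b ^ p" "\<forall>i<p. (k div b ^ i) mod b = a i" by auto
  have b: "b > 0" using Suc.prems[of p] by auto
  let ?k = "k + a p * b ^ p"
  have "?k < b ^ p + a p * b ^ p" using k by simp
  also have "\<dots> = (a p + 1) * b ^ p" by simp
  also have "\<dots> \<le> b * b ^ p" using Suc.prems[of p] by (intro mult_right_mono) auto
  finally have 1: "?k < b ^ Suc p" by simp
  have "(?k div b ^ i) mod b = a i" if "i < Suc p" for i
  proof (cases "i = p")
    case True
    then show ?thesis using k(1) b Suc.prems[of p] by simp
  next
    case False
    then have "i < p" using that by simp
    then obtain j where j: "p = i + Suc j"
      by (metis less_iff_Suc_add add_Suc_right)
    have "?k = k + (a p * b ^ j * b) * b ^ i" by (simp add: j power_add algebra_simps)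
    then have "?k div b ^ i = a p * b ^ j * b + k div b ^ i" using b
      by (metis add.commute div_mult_self1 power_not_zero less_numeral_extra(3))
    then show ?thesis using k(2) \<open>i < p\<close> by simp
  qed
  with 1 show ?case by blast
qed auto

lemma nth_monomial_surj:
  assumes "D \<in> polys p" "m \<in> Poly_Mapping.keys D"
  shows "\<exists>k < (max_degree D + 1) ^ p. nth_monomial p (max_degree D) k = m"
proof -
  have le: "Poly_Mapping.lookup m i \<le> max_degree D" for i
  proof (cases "i \<in> Poly_Mapping.keys m")
    case True
    then show ?thesis unfolding max_degree_def using assms(2) by (intro Max_ge) auto
  qed (simp add: in_keys_iff)
  then have "\<exists>k < (max_degree D + 1) ^ p. \<forall>i < p.
      (k div (max_degree D + 1) ^ i) mod (max_degree D + 1) = Poly_Mapping.lookup m (Suc i)"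
    by (intro digits_exist) (simp add: less_Suc_eq_le)
  then obtain k where k: "k < (max_degree D + 1) ^ p"
    "\<And>i. i < p \<Longrightarrow>
      (k div (max_degree D + 1) ^ i) mod (max_degree D + 1) = Poly_Mapping.lookup m (Suc i)"
    by blast
  have "Poly_Mapping.lookup (nth_monomial p (max_degree D) k) i = Poly_Mapping.lookup m i" for i
  proof (cases "i \<in> {1..p}")
    case True
    then show ?thesis using k(2)[of "i - 1"] by (auto simp: lookup_nth_monomial)
  next
    case False
    then show ?thesis using assms by (force simp: lookup_nth_monomial polys_def in_keys_iff)
  qed
  then show ?thesis using k(1) by (blast intro: poly_mapping_eqI)
qed

lemma poly_code_inj:
  assumes "p \<ge> 1" "D \<in> polys p" "D' \<in> polys p'" "poly_code p D = poly_code p' D'"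
  shows "p = p' \<and> D = D'"
proof -
  have p: "p = p'" and c: "coeff_list p D = coeff_list p' D'"
    using assms(4) by (auto simp: poly_code_def list_encode_eq inj_map_eq_map[OF inj_int_encode])
  have "(max_degree D + 1) ^ p = (max_degree D' + 1) ^ p"
    using arg_cong[OF c, of length] p by (simp add: coeff_list_def)
  then have d: "max_degree D = max_degree D'"
    using power_eq_imp_eq_base[of "max_degree D + 1" p "max_degree D' + 1"] assms(1) by simp
  have eq: "Poly_Mapping.lookup D (nth_monomial p (max_degree D) k) =
      Poly_Mapping.lookup D' (nth_monomial p (max_degree D) k)"
    if "k < (max_degree D + 1) ^ p" for k
    using arg_cong[OF c, of "\<lambda>l. l ! k"] that by (simp add: coeff_list_def flip: p d)
  have "Poly_Mapping.lookup D m = Poly_Mapping.lookup D' m" for m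
  proof (cases "m \<in> Poly_Mapping.keys D \<or> m \<in> Poly_Mapping.keys D'")
    case True
    then obtain k where "k < (max_degree D + 1) ^ p" "nth_monomial p (max_degree D) k = m"
      using nth_monomial_surj[OF assms(2), of m] nth_monomial_surj[OF assms(3), of m]
      unfolding p d by blast
    then show ?thesis using eq by blast
  qed (simp add: in_keys_iff)
  then show ?thesis using p by (blast intro: poly_mapping_eqI)
qed

subsection \<open>Partial recursive functions\<close>

datatype recf =
    Zero
  | Succ
  | Proj nat
  | Comp recf "recf list"
  | PrimRec recf recf
  | Mu recf

text \<open>\<open>evaluates f xs y\<close>: the function described by \<open>f\<close> is defined at the argument tuple
  \<open>xs\<close>, with value \<open>y\<close>. The recursion variable of \<open>PrimRec\<close> and the search variable of
  \<open>Mu\<close> are the first argument.\<close>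

inductive evaluates :: "recf \<Rightarrow> nat list \<Rightarrow> nat \<Rightarrow> bool" where
  Zero: "evaluates Zero xs 0"
| Succ: "evaluates Succ [x] (Suc x)"
| Proj: "i < length xs \<Longrightarrow> evaluates (Proj i) xs (xs ! i)"
| Comp: "list_all2 (\<lambda>g y. evaluates g xs y) gs ys \<Longrightarrow> evaluates f ys z \<Longrightarrow>
    evaluates (Comp f gs) xs z"
| PrimRec_0: "evaluates f xs y \<Longrightarrow> evaluates (PrimRec f g) (0 # xs) y"
| PrimRec_Suc: "evaluates (PrimRec f g) (n # xs) y \<Longrightarrow> evaluates g (n # y # xs) z \<Longrightarrow>
    evaluates (PrimRec f g) (Suc n # xs) z"
| Mu: "evaluates f (n # xs) 0 \<Longrightarrow> (\<forall>m < n. \<exists>y. evaluates f (m # xs) (Suc y)) \<Longrightarrow>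
    evaluates (Mu f) xs n"

inductive_cases evaluates_elims:
  "evaluates Zero xs y"
  "evaluates Succ xs y"
  "evaluates (Proj i) xs y"
  "evaluates (Comp f gs) xs y"
  "evaluates (PrimRec f g) (0 # xs) y"
  "evaluates (PrimRec f g) (Suc n # xs) y"
  "evaluates (Mu f) xs y"

lemma evaluates_functional:
  "evaluates f xs y \<Longrightarrow> evaluates f xs z \<Longrightarrow> y = z"
proof (induction arbitrary: z rule: evaluates.induct)
  case (Comp xs gs ys f u)
  from Comp.prems obtain ys' where ys': "list_all2 (\<lambda>g y. evaluates g xs y) gs ys'"
    "evaluates f ys' z" by (blast elim: evaluates_elims(4))
  have "ys = ys'"
    using Comp.IH(1) ys'(1) by (auto simp: list_all2_conv_all_nth intro: nth_equalityI)
  with ys' Comp.IH(2) show ?case by simp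
next
  case (PrimRec_Suc f g n xs y u)
  from PrimRec_Suc.prems obtain y' where "evaluates (PrimRec f g) (n # xs) y'"
    "evaluates g (n # y' # xs) z" by (blast elim: evaluates_elims(6))
  with PrimRec_Suc.IH show ?case by blast
next
  case (Mu f n xs)
  from Mu.prems have z: "evaluates f (z # xs) 0" "\<forall>m<z. \<exists>y. evaluates f (m # xs) (Suc y)"
    by (rule evaluates_elims(7), simp)+
  show ?case
  proof (rule linorder_cases[of n z])
    assume "n < z"
    with z(2) Mu.IH(1) show ?thesis by blast
  next
    assume "z < n"
    with z(1) Mu.IH(2) show ?thesis by fastforce
  qed auto
qed (blast elim: evaluates_elims)+

text \<open>The description \<open>f\<close> must serve all polynomials in all numbers of variables; its
  behaviour on numbers that encode no polynomial is immaterial.\<close>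

definition computable_on_polys :: "(nat \<Rightarrow> int_mpoly \<Rightarrow> nat) \<Rightarrow> bool" where
  "computable_on_polys B \<longleftrightarrow>
     (\<exists>f. \<forall>p \<ge> 1. \<forall>D \<in> polys p. evaluates f [poly_code p D] (B p D))"

end

theory Submission
  imports Defs "HOL-Computational_Algebra.Primes" "HOL-Library.Discrete_Functions"
begin

text \<open>
Conjecture (T) bounds the integer solutions of a system of elementary equations by a function of
the number of unknowns. Two things are needed to profit from it: a polynomial \<open>D\<close> has to be turned
into a system over the integers that is finite whenever the set of rational zeros of \<open>D\<close> is, and
the number of unknowns has to be bounded by a computable function of the code of \<open>D\<close>.

For the first, each rational coordinate is written as \<open>y / z\<close> in lowest terms with \<open>z > 0\<close>. The pair
\<open>(y, z)\<close> is then unique. Only polynomial equations are available to single it out, so coprimality and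
positivity need auxiliary unknowns, and only finitely many values of these may belong to a given
pair. Among the Bezout identities \<open>s y + t z = 1\<close> exactly one has \<open>0 \<le> s < z\<close>, and the inequalities
are expressed by Lagrange's theorem: \<open>s\<close> and \<open>z - 1 - s\<close> are sums of four squares, in finitely many
ways. With denominators cleared, the rational zeros of \<open>D\<close> are the images of the integer zeros of a
list of polynomial expressions, each with finite nonempty fibre
(\<open>point_in_rat_solutions\<close>, \<open>finite_zero_system\<close>, \<open>rat_solution_lifts\<close>).

A list of polynomial expressions becomes a system of elementary equations by taking one unknown
for each distinct subexpression (\<open>conjecture_T_bounds_common_zeros\<close>).

For the second, the number of variables, the degree, the number of monomials and the absolute
values of the coefficients are all at most the code \<open>c\<close> of \<open>D\<close>, so the number of unknowns is at
most a fixed polynomial in \<open>c\<close> (\<open>nodes_zero_system\<close>). The bound is therefore a function of \<open>c\<close>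
alone, built from the successor function, doubling and powers of two.
\<close>

section \<open>Sums of four squares\<close>

definition four_squares :: "int \<Rightarrow> bool" where
  "four_squares n \<longleftrightarrow> (\<exists>a b c d. n = a\<^sup>2 + b\<^sup>2 + c\<^sup>2 + d\<^sup>2)"

text \<open>Multiplicativity of the quaternion norm, with the second factor conjugated: the cross terms of the
last three squares then vanish modulo \<open>m\<close> when both quadruples agree modulo \<open>m\<close>, which is what the
descent for \<open>m = 3\<close> below exploits.\<close>

lemma euler_four_square:
  fixes a b c d e f g h :: int
  shows "(a\<^sup>2 + b\<^sup>2 + c\<^sup>2 + d\<^sup>2) * (e\<^sup>2 + f\<^sup>2 + g\<^sup>2 + h\<^sup>2) =
    (a*e + b*f + c*g + d*h)\<^sup>2 + (a*f - b*e + c*h - d*g)\<^sup>2 +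
    (a*g - c*e + d*f - b*h)\<^sup>2 + (a*h - d*e + b*g - c*f)\<^sup>2"
  by (simp add: power2_eq_square algebra_simps)

lemma four_squares_mult: "four_squares m \<Longrightarrow> four_squares n \<Longrightarrow> four_squares (m * n)"
  unfolding four_squares_def using euler_four_square by metis

text \<open>The four entries can be paired so that each pair has equal parity; then
\<open>((x + y) / 2)\<^sup>2 + ((x - y) / 2)\<^sup>2 = (x\<^sup>2 + y\<^sup>2) / 2\<close>.\<close>

lemma four_squares_half:
  assumes "four_squares (2 * n)"
  shows "four_squares n"
proof -
  obtain a b c d where eq: "2 * n = a\<^sup>2 + b\<^sup>2 + c\<^sup>2 + d\<^sup>2"
    using assms by (auto simp: four_squares_def)
  have paired: ?thesis if n: "2 * n = x\<^sup>2 + y\<^sup>2 + z\<^sup>2 + w\<^sup>2" and ev: "even (x + y)" "even (z + w)"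
    for x y z w
  proof -
    obtain k l where "x + y = 2 * k" "z + w = 2 * l" using ev by (meson dvdE)
    then have x: "x = 2 * k - y" and z: "z = 2 * l - w" by auto
    have "n = k\<^sup>2 + (k - y)\<^sup>2 + l\<^sup>2 + (l - w)\<^sup>2"
      using n unfolding x z by (simp add: power2_eq_square algebra_simps)
    then show ?thesis unfolding four_squares_def by blast
  qed
  have "even (a + b + c + d)"
    using dvd_triv_left[of 2 n] unfolding eq by simp
  then consider "even (a + b)" "even (c + d)" | "even (a + c)" "even (b + d)"
    | "even (a + d)" "even (b + c)" by fastforce
  then show ?thesis
    using paired[of a b c d] paired[of a c b d] paired[of a d b c] eq by cases (auto simp: algebra_simps)
qed

text \<open>One step of Lagrange's descent. The entries are replaced by their residues in \<open>{-1, 0, 1}\<close>, whose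
squares sum to \<open>0\<close> or \<open>3\<close>. In the first case \<open>n\<close> is three times a sum of four squares; in the second
Euler's identity writes \<open>3 n \<cdot> 3\<close> as the sum of the squares of four multiples of \<open>3\<close>.\<close>

lemma four_squares_third:
  assumes "four_squares (3 * n)"
  shows "four_squares n"
proof -
  obtain a b c d where eq: "3 * n = a\<^sup>2 + b\<^sup>2 + c\<^sup>2 + d\<^sup>2"
    using assms by (auto simp: four_squares_def)
  have residue: "\<exists>k r. x = 3 * k + r \<and> (r = 0 \<or> r = 1 \<or> r = - 1)" for x :: int
  proof -
    have "x mod 3 = 0 \<or> x mod 3 = 1 \<or> x mod 3 = 2" by auto
    then have "x = 3 * (x div 3) + 0 \<or> x = 3 * (x div 3) + 1 \<or> x = 3 * (x div 3 + 1) + - 1"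
      by presburger
    then show ?thesis by blast
  qed
  obtain a' e where a: "a = 3 * a' + e" "e = 0 \<or> e = 1 \<or> e = - 1" using residue by blast
  obtain b' f where b: "b = 3 * b' + f" "f = 0 \<or> f = 1 \<or> f = - 1" using residue by blast
  obtain c' g where c: "c = 3 * c' + g" "g = 0 \<or> g = 1 \<or> g = - 1" using residue by blast
  obtain d' h where d: "d = 3 * d' + h" "h = 0 \<or> h = 1 \<or> h = - 1" using residue by blast
  have "e\<^sup>2 + f\<^sup>2 + g\<^sup>2 + h\<^sup>2 =
    3 * (n - 3 * (a'\<^sup>2 + b'\<^sup>2 + c'\<^sup>2 + d'\<^sup>2) - 2 * (a' * e + b' * f + c' * g + d' * h))"
    using eq by (simp add: a(1) b(1) c(1) d(1) power2_eq_square algebra_simps)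
  then have "3 dvd e\<^sup>2 + f\<^sup>2 + g\<^sup>2 + h\<^sup>2" by (metis dvd_triv_left)
  then consider "e = 0" "f = 0" "g = 0" "h = 0" | "e\<^sup>2 + f\<^sup>2 + g\<^sup>2 + h\<^sup>2 = 3"
    using a(2) b(2) c(2) d(2) by (elim disjE) simp_all
  then show ?thesis
  proof cases
    case 1
    then have "n = 3 * (a'\<^sup>2 + b'\<^sup>2 + c'\<^sup>2 + d'\<^sup>2)"
      using eq a(1) b(1) c(1) d(1) by (simp add: power2_eq_square)
    moreover have "four_squares 3"
      unfolding four_squares_def
      by (rule exI[of _ 1], rule exI[of _ 1], rule exI[of _ 1], rule exI[of _ 0]) simp
    ultimately show ?thesis using four_squares_mult unfolding four_squares_def by metis
  next
    case 2
    have "3 * n * 3 = (a\<^sup>2 + b\<^sup>2 + c\<^sup>2 + d\<^sup>2) * (e\<^sup>2 + f\<^sup>2 + g\<^sup>2 + h\<^sup>2)"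
      using eq 2 by simp
    also have "\<dots> = (a*e + b*f + c*g + d*h)\<^sup>2 + (a*f - b*e + c*h - d*g)\<^sup>2 +
      (a*g - c*e + d*f - b*h)\<^sup>2 + (a*h - d*e + b*g - c*f)\<^sup>2"
      by (rule euler_four_square)
    also have "a*e + b*f + c*g + d*h = 3 * (a' * e + b' * f + c' * g + d' * h + 1)"
      using 2 by (simp add: a(1) b(1) c(1) d(1) power2_eq_square algebra_simps)
    also have "a*f - b*e + c*h - d*g = 3 * (a' * f - b' * e + c' * h - d' * g)"
      by (simp add: a(1) b(1) c(1) d(1) algebra_simps)
    also have "a*g - c*e + d*f - b*h = 3 * (a' * g - c' * e + d' * f - b' * h)"
      by (simp add: a(1) b(1) c(1) d(1) algebra_simps)
    also have "a*h - d*e + b*g - c*f = 3 * (a' * h - d' * e + b' * g - c' * f)"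
      by (simp add: a(1) b(1) c(1) d(1) algebra_simps)
    finally have "n = (a' * e + b' * f + c' * g + d' * h + 1)\<^sup>2
      + (a' * f - b' * e + c' * h - d' * g)\<^sup>2 + (a' * g - c' * e + d' * f - b' * h)\<^sup>2
      + (a' * h - d' * e + b' * g - c' * f)\<^sup>2"
      unfolding power_mult_distrib by simp
    then show ?thesis unfolding four_squares_def by blast
  qed
qed

text \<open>For odd \<open>p\<close> both \<open>x\<^sup>2\<close> and \<open>- 1 - y\<^sup>2\<close> take \<open>(p + 1) / 2\<close> values modulo \<open>p\<close>, so they share one.\<close>

lemma two_squares_plus_one_mod_prime:
  fixes p :: nat
  assumes "prime p"
  shows "\<exists>x y :: int. int p dvd x\<^sup>2 + y\<^sup>2 + 1"
proof (cases "p = 2")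
  case True
  then show ?thesis by (intro exI[of _ 1] exI[of _ 0]) simp
next
  case False
  then have "odd p" using assms primes_dvd_imp_eq two_is_prime_nat by blast
  then obtain h where h: "p = 2 * h + 1" by (elim oddE)
  have ip: "prime (int p)" using assms by simp
  let ?X = "{0..int h}"
  have inj: "x = y" if "x \<in> ?X" "y \<in> ?X" "int p dvd x\<^sup>2 - y\<^sup>2" for x y
  proof -
    have "int p dvd (x - y) * (x + y)"
      using that(3) by (simp add: power2_eq_square algebra_simps)
    then consider "int p dvd x - y" | "int p dvd x + y" using ip prime_dvd_mult_iff by blast
    then show ?thesis
    proof cases
      case 1
      show ?thesis
      proof (rule ccontr)
        assume "x \<noteq> y"
        then have "int p \<le> \<bar>x - y\<bar>" using dvd_imp_le_int[of "x - y" "int p"] 1 by simp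
        then show False using that h by auto
      qed
    next
      case 2
      show ?thesis
      proof (rule ccontr)
        assume "x \<noteq> y"
        then have "int p \<le> \<bar>x + y\<bar>" using dvd_imp_le_int[of "x + y" "int p"] 2 that by auto
        then show False using that h by auto
      qed
    qed
  qed
  let ?f = "\<lambda>x. x\<^sup>2 mod int p" and ?g = "\<lambda>y. (- 1 - y\<^sup>2) mod int p"
  have "inj_on ?f ?X" by (rule inj_onI) (metis inj mod_eq_dvd_iff)
  then have f: "card (?f ` ?X) = h + 1" by (simp add: card_image)
  have "inj_on ?g ?X"
  proof (rule inj_onI)
    fix x y assume "x \<in> ?X" "y \<in> ?X" "?g x = ?g y"
    moreover from this have "int p dvd y\<^sup>2 - x\<^sup>2" by (simp add: mod_eq_dvd_iff)
    ultimately show "x = y" using inj by metis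
  qed
  then have g: "card (?g ` ?X) = h + 1" by (simp add: card_image)
  have sub: "?f ` ?X \<union> ?g ` ?X \<subseteq> {0..<int p}" using h by auto
  have "?f ` ?X \<inter> ?g ` ?X \<noteq> {}"
  proof
    assume "?f ` ?X \<inter> ?g ` ?X = {}"
    then have "card (?f ` ?X \<union> ?g ` ?X) = 2 * h + 2"
      using f g by (simp add: card_Un_disjoint)
    then show False using card_mono[OF _ sub] h by simp
  qed
  then obtain x y where "x\<^sup>2 mod int p = (- 1 - y\<^sup>2) mod int p" by blast
  then have "int p dvd x\<^sup>2 - (- 1 - y\<^sup>2)" by (simp only: mod_eq_dvd_iff)
  then show ?thesis by (intro exI[of _ x] exI[of _ y]) (simp add: algebra_simps)
qed

text \<open>With \<open>x\<^sup>2 + y\<^sup>2 \<equiv> - 1\<close> modulo \<open>p\<close>, the congruences \<open>c \<equiv> x a + y b\<close> and \<open>d \<equiv> x b - y a\<close> force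
\<open>p\<close> to divide \<open>a\<^sup>2 + b\<^sup>2 + c\<^sup>2 + d\<^sup>2\<close>. More than \<open>p\<^sup>2\<close> quadruples have entries between \<open>0\<close> and
\<open>\<surd>p\<close>, so two of them agree in both congruences, and their difference is a nonzero solution with
entries at most \<open>\<surd>p\<close>. Hence one of \<open>p\<close>, \<open>2 p\<close>, \<open>3 p\<close>, \<open>4 p\<close> is a sum of four squares.\<close>

lemma four_squares_prime:
  fixes p :: nat
  assumes "prime p"
  shows "four_squares (int p)"
proof -
  obtain x y :: int where xy: "int p dvd x\<^sup>2 + y\<^sup>2 + 1"
    using two_squares_plus_one_mod_prime[OF assms] by blast
  have p: "p > 0" using assms by (simp add: prime_gt_0_nat)
  define r where "r = floor_sqrt p"
  have r: "r * r \<le> p" "p < (r + 1) * (r + 1)"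
    unfolding r_def using floor_sqrt_power2_le[of p] Suc_floor_sqrt_power2_gt[of p]
    by (auto simp: power2_eq_square)
  let ?R = "{0..int r}" and ?P = "{0..<int p}"
  let ?A = "?R \<times> ?R \<times> ?R \<times> ?R"
  define \<phi> where "\<phi> = (\<lambda>(a, b, c, d). ((c - (x * a + y * b)) mod int p, (d - (x * b - y * a)) mod int p))"
  have "card (?P \<times> ?P) = p * p" by simp
  also have "\<dots> < ((r + 1) * (r + 1)) * ((r + 1) * (r + 1))"
    using r(2) by (intro mult_strict_mono) auto
  also have "card ?R = r + 1" by (simp add: nat_add_distrib)
  then have "((r + 1) * (r + 1)) * ((r + 1) * (r + 1)) = card ?A"
    by (simp only: card_cartesian_product mult.assoc)
  finally have "card (?P \<times> ?P) < card ?A" .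
  moreover have "\<phi> ` ?A \<subseteq> ?P \<times> ?P" using p by (auto simp: \<phi>_def)
  then have "inj_on \<phi> ?A \<Longrightarrow> card ?A \<le> card (?P \<times> ?P)"
    by (rule card_inj_on_le[rotated]) simp_all
  ultimately have "\<not> inj_on \<phi> ?A" by linarith
  then obtain u v where uv: "u \<in> ?A" "v \<in> ?A" "\<phi> u = \<phi> v" "u \<noteq> v" by (meson inj_onI)
  obtain a1 b1 c1 d1 a2 b2 c2 d2 where u: "u = (a1, b1, c1, d1)" and v: "v = (a2, b2, c2, d2)"
    by (metis prod_cases4)
  define a b c d where abcd: "a = a1 - a2" "b = b1 - b2" "c = c1 - c2" "d = d1 - d2"
  have nz: "a \<noteq> 0 \<or> b \<noteq> 0 \<or> c \<noteq> 0 \<or> d \<noteq> 0" using uv(4) by (auto simp: abcd u v)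
  have le: "\<bar>a\<bar> \<le> int r" "\<bar>b\<bar> \<le> int r" "\<bar>c\<bar> \<le> int r" "\<bar>d\<bar> \<le> int r"
    using uv(1,2) by (auto simp: abcd u v)
  have "int p dvd (c1 - (x * a1 + y * b1)) - (c2 - (x * a2 + y * b2))"
    "int p dvd (d1 - (x * b1 - y * a1)) - (d2 - (x * b2 - y * a2))"
    using uv(3) by (simp_all only: \<phi>_def u v prod.case prod.inject mod_eq_dvd_iff)
  then obtain k l where
      "(c1 - (x * a1 + y * b1)) - (c2 - (x * a2 + y * b2)) = int p * k"
      "(d1 - (x * b1 - y * a1)) - (d2 - (x * b2 - y * a2)) = int p * l"
    by (elim dvdE)
  then have kl: "c = x * a + y * b + int p * k" "d = x * b - y * a + int p * l"
    unfolding abcd by (simp_all add: algebra_simps)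
  obtain q where q: "x\<^sup>2 + y\<^sup>2 + 1 = int p * q" using xy by (elim dvdE)
  let ?N = "a\<^sup>2 + b\<^sup>2 + c\<^sup>2 + d\<^sup>2"
  have "?N = (a\<^sup>2 + b\<^sup>2) * (x\<^sup>2 + y\<^sup>2 + 1) + int p * (k * (2 * (x * a + y * b) + int p * k)
     + l * (2 * (x * b - y * a) + int p * l))"
    unfolding kl by (simp add: power2_eq_square algebra_simps)
  also have "\<dots> = int p * ((a\<^sup>2 + b\<^sup>2) * q + k * (2 * (x * a + y * b) + int p * k)
     + l * (2 * (x * b - y * a) + int p * l))"
    unfolding q by (simp add: algebra_simps)
  finally obtain m where m: "?N = int p * m" by blast
  have "?N \<noteq> 0" using nz by (simp add: add_nonneg_eq_0_iff)
  then have "?N > 0" by (simp add: less_le)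
  then have "m > 0" using m p by (simp add: zero_less_mult_iff)
  have sq: "z\<^sup>2 \<le> int p" if "\<bar>z\<bar> \<le> int r" for z :: int
  proof -
    have "z\<^sup>2 \<le> (int r)\<^sup>2" using that by (simp add: abs_le_square_iff[symmetric])
    also have "\<dots> \<le> int p" using r(1) by (simp add: power2_eq_square flip: of_nat_mult)
    finally show ?thesis .
  qed
  have "int p * m \<le> int p * 4" using sq[OF le(1)] sq[OF le(2)] sq[OF le(3)] sq[OF le(4)] m by simp
  then have "m \<le> 4" using p by simp
  with \<open>m > 0\<close> consider "m = 1" | "m = 2" | "m = 3" | "m = 4" by linarith
  moreover have fs: "four_squares (m * int p)"
    unfolding four_squares_def using m by (metis mult.commute)
  ultimately show ?thesis
  proof cases
    case 1
    with fs show ?thesis by simp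
  next
    case 2
    with fs show ?thesis using four_squares_half by simp
  next
    case 3
    with fs show ?thesis using four_squares_third by simp
  next
    case 4
    with fs have "four_squares (2 * (2 * int p))" by simp
    then show ?thesis by (rule four_squares_half[OF four_squares_half])
  qed
qed

theorem lagrange_four_squares:
  assumes "n \<ge> (0 :: int)"
  obtains a b c d where "n = a\<^sup>2 + b\<^sup>2 + c\<^sup>2 + d\<^sup>2"
proof -
  have "four_squares (int k)" for k
  proof (induction k rule: prime_divisors_induct)
    case zero
    show ?case unfolding four_squares_def by (intro exI[of _ 0]) simp
  next
    case (unit k)
    then have "k = 1" by simp
    then show ?case unfolding four_squares_def
      by (intro exI[of _ 1] exI[of _ 0]) simp
  next
    case (factor q k)
    then show ?case using four_squares_mult[OF four_squares_prime] by simp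
  qed
  from this[of "nat n"] show ?thesis using that assms by (auto simp: four_squares_def)
qed

section \<open>Polynomial expressions as systems of elementary equations\<close>

datatype 'v expr =
    Var 'v
  | Unit
  | Plus "'v expr" "'v expr"
  | Minus "'v expr" "'v expr"
  | Times "'v expr" "'v expr"

primrec expr_val :: "'v expr \<Rightarrow> ('v \<Rightarrow> int) \<Rightarrow> int" where
  "expr_val (Var v) \<sigma> = \<sigma> v"
| "expr_val Unit \<sigma> = 1"
| "expr_val (Plus a b) \<sigma> = expr_val a \<sigma> + expr_val b \<sigma>"
| "expr_val (Minus a b) \<sigma> = expr_val a \<sigma> - expr_val b \<sigma>"
| "expr_val (Times a b) \<sigma> = expr_val a \<sigma> * expr_val b \<sigma>"

primrec subexprs :: "'v expr \<Rightarrow> 'v expr set" where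
  "subexprs (Var v) = {Var v}"
| "subexprs Unit = {Unit}"
| "subexprs (Plus a b) = insert (Plus a b) (subexprs a \<union> subexprs b)"
| "subexprs (Minus a b) = insert (Minus a b) (subexprs a \<union> subexprs b)"
| "subexprs (Times a b) = insert (Times a b) (subexprs a \<union> subexprs b)"

primrec nodes :: "'v expr \<Rightarrow> nat" where
  "nodes (Var v) = 1"
| "nodes Unit = 1"
| "nodes (Plus a b) = nodes a + nodes b + 1"
| "nodes (Minus a b) = nodes a + nodes b + 1"
| "nodes (Times a b) = nodes a + nodes b + 1"

lemma self_in_subexprs: "e \<in> subexprs e"
  by (cases e) auto

lemma subexprs_trans: "a \<in> subexprs b \<Longrightarrow> subexprs a \<subseteq> subexprs b"
  by (induction b) auto

lemma finite_subexprs: "finite (subexprs e)"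
  by (induction e) auto

lemma card_subexprs_le: "card (subexprs e) \<le> nodes e"
proof -
  have step: "card (insert x (A \<union> B)) \<le> m + n + 1"
    if "card A \<le> m" "card B \<le> n" for x :: "'v expr" and A B m n
  proof -
    have "card (A \<union> B) \<le> m + n" using card_Un_le[of A B] that by linarith
    moreover have "card (insert x (A \<union> B)) \<le> card (A \<union> B) + 1"
      by (cases "finite (A \<union> B)") (auto simp: card_insert_if)
    ultimately show ?thesis by linarith
  qed
  show ?thesis
    by (induction e) (simp_all only: subexprs.simps nodes.simps step, simp_all)
qed

lemma card_UN_subexprs_le: "card (\<Union>e\<in>set es. subexprs e) \<le> sum_list (map nodes es)"
proof (induction es)
  case (Cons e es)
  have "card (\<Union>a\<in>set (e # es). subexprs a) \<le> card (subexprs e) + card (\<Union>a\<in>set es. subexprs a)"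
    using card_Un_le by simp
  also have "\<dots> \<le> nodes e + sum_list (map nodes es)"
    using Cons.IH card_subexprs_le by (rule add_mono[rotated])
  finally show ?case by simp
qed simp

lemma expr_val_cong: "(\<And>v. v \<in> set_expr e \<Longrightarrow> \<sigma> v = \<tau> v) \<Longrightarrow> expr_val e \<sigma> = expr_val e \<tau>"
  by (induction e) auto

lemma var_in_subexprs: "v \<in> set_expr e \<longleftrightarrow> Var v \<in> subexprs e"
  by (induction e) auto

definition vars :: "'v expr list \<Rightarrow> 'v set" where
  "vars es = (\<Union>e\<in>set es. set_expr e)"

text \<open>Assignments are extensional on the variables that occur, so that finiteness of this set means
finiteness of the number of genuine tuples.\<close>

definition common_zeros :: "'v expr list \<Rightarrow> ('v \<Rightarrow> int) set" where
  "common_zeros es = {\<sigma> \<in> vars es \<rightarrow>\<^sub>E UNIV. \<forall>e \<in> set es. expr_val e \<sigma> = 0}"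

text \<open>The distinct subexpressions serve as the unknowns of a system of elementary equations. A solution
is determined by its values at the variables, so this system has as many solutions as the
expressions have common zeros, and the number of unknowns is at most the total number of nodes.
Naming the unknowns by the subexpressions themselves avoids any choice of fresh variables.\<close>

theorem conjecture_T_bounds_common_zeros:
  assumes T: conjecture_T
    and fin: "finite (common_zeros es)"
    and \<sigma>: "\<sigma> \<in> common_zeros es" and v: "v \<in> vars es"
  shows "\<bar>\<sigma> v\<bar> \<le> 2 ^ (2 ^ sum_list (map nodes es))"
proof -
  let ?U = "set es"
  define A where "A = (\<Union>e\<in>?U. subexprs e)"
  define n where "n = card A"
  have finA: "finite A" unfolding A_def using finite_subexprs by blast
  have UA: "e \<in> A" if "e \<in> ?U" for e using that self_in_subexprs unfolding A_def by blast
  have closed: "subexprs e \<subseteq> A" if "e \<in> A" for e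
    using that subexprs_trans unfolding A_def by blast
  have VA: "Var w \<in> A \<longleftrightarrow> w \<in> vars es" for w
    by (simp add: A_def vars_def var_in_subexprs)
  have "\<exists>\<iota>. bij_betw \<iota> A {1..n}"
    by (rule finite_same_card_bij) (simp_all add: finA n_def)
  then obtain \<iota> where \<iota>: "bij_betw \<iota> A {1..n}" ..
  have \<iota>_in: "\<iota> e \<in> {1..n}" if "e \<in> A" for e using \<iota> that by (auto simp: bij_betw_def)
  have inv: "the_inv_into A \<iota> (\<iota> e) = e" if "e \<in> A" for e
    using \<iota> that by (simp add: bij_betw_def the_inv_into_f_f)
  have inv_in: "the_inv_into A \<iota> i \<in> A" "\<iota> (the_inv_into A \<iota> i) = i" if "i \<in> {1..n}" for i
    using \<iota> that by (auto simp: bij_betw_def the_inv_into_into f_the_inv_into_f)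
  have sub: "a \<in> A \<and> b \<in> A" if "Plus a b \<in> A \<or> Minus a b \<in> A \<or> Times a b \<in> A" for a b
    using that closed[of "Plus a b"] closed[of "Minus a b"] closed[of "Times a b"]
      self_in_subexprs[of a] self_in_subexprs[of b] by auto
  (* Every operation node becomes one equation between numbered subexpressions; a difference is
     stated as a sum. The equation v + v = v says that the root of e vanishes. *)
  define S where "S =
    {One (\<iota> Unit) | _ :: unit. Unit \<in> A} \<union>
    {Add (\<iota> a) (\<iota> b) (\<iota> (Plus a b)) | a b. Plus a b \<in> A} \<union>
    {Add (\<iota> (Minus a b)) (\<iota> b) (\<iota> a) | a b. Minus a b \<in> A} \<union>
    {Mult (\<iota> a) (\<iota> b) (\<iota> (Times a b)) | a b. Times a b \<in> A} \<union>
    {Add (\<iota> e) (\<iota> e) (\<iota> e) | e. e \<in> ?U}"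
  have "S \<subseteq> E n"
    unfolding S_def E_def using \<iota>_in sub UA by blast
  (* The solutions of S are exactly the tuples of values of all subexpressions. *)
  define enc where "enc \<tau> = (\<lambda>i\<in>{1..n}. expr_val (the_inv_into A \<iota> i) \<tau>)" for \<tau>
  have enc: "enc \<tau> (\<iota> e) = expr_val e \<tau>" if "e \<in> A" for \<tau> e
    using that \<iota>_in inv by (simp add: enc_def)
  have enc_sol: "enc \<tau> \<in> int_solutions n S" if "\<tau> \<in> common_zeros es" for \<tau>
  proof -
    have "satisfies (enc \<tau>) q" if "q \<in> S" for q
      using that unfolding S_def
    proof (elim UnE CollectE exE conjE)
      fix a b assume "q = Add (\<iota> a) (\<iota> b) (\<iota> (Plus a b))" "Plus a b \<in> A"
      then show ?thesis using sub[of a b] by (simp add: enc)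
    next
      fix a b assume "q = Add (\<iota> (Minus a b)) (\<iota> b) (\<iota> a)" "Minus a b \<in> A"
      then show ?thesis using sub[of a b] by (simp add: enc)
    next
      fix a b assume "q = Mult (\<iota> a) (\<iota> b) (\<iota> (Times a b))" "Times a b \<in> A"
      then show ?thesis using sub[of a b] by (simp add: enc)
    next
      fix e assume "q = Add (\<iota> e) (\<iota> e) (\<iota> e)" "e \<in> ?U"
      then show ?thesis
        using \<open>\<tau> \<in> common_zeros es\<close> UA by (simp add: enc common_zeros_def)
    qed (simp add: enc)
    then show ?thesis by (simp add: int_solutions_def enc_def)
  qed
  have sol_enc: "x \<in> enc ` common_zeros es" if x: "x \<in> int_solutions n S" for x
  proof -
    define \<tau> where "\<tau> = (\<lambda>w\<in>vars es. x (\<iota> (Var w)))"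
    have sat: "satisfies x q" if "q \<in> S" for q
      using x that by (simp add: int_solutions_def)
    have val: "x (\<iota> e) = expr_val e \<tau>" if "e \<in> A" for e
      using that
    proof (induction e)
      case (Var w)
      then show ?case using VA by (simp add: \<tau>_def)
    next
      case Unit
      then have "One (\<iota> Unit) \<in> S" unfolding S_def by blast
      then show ?case using sat[of "One (\<iota> Unit)"] by simp
    next
      case (Plus a b)
      then have "Add (\<iota> a) (\<iota> b) (\<iota> (Plus a b)) \<in> S" unfolding S_def by blast
      then show ?case using sat[of "Add (\<iota> a) (\<iota> b) (\<iota> (Plus a b))"] sub[of a b] Plus by simp
    next
      case (Minus a b)
      then have "Add (\<iota> (Minus a b)) (\<iota> b) (\<iota> a) \<in> S" unfolding S_def by blast
      then show ?case using sat[of "Add (\<iota> (Minus a b)) (\<iota> b) (\<iota> a)"] sub[of a b] Minus by simp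
    next
      case (Times a b)
      then have "Mult (\<iota> a) (\<iota> b) (\<iota> (Times a b)) \<in> S" unfolding S_def by blast
      then show ?case using sat[of "Mult (\<iota> a) (\<iota> b) (\<iota> (Times a b))"] sub[of a b] Times by simp
    qed
    have "expr_val e \<tau> = 0" if "e \<in> ?U" for e
    proof -
      have "Add (\<iota> e) (\<iota> e) (\<iota> e) \<in> S" using that unfolding S_def by blast
      then show ?thesis using sat[of "Add (\<iota> e) (\<iota> e) (\<iota> e)"] val[OF UA[OF that]] by simp
    qed
    then have "\<tau> \<in> common_zeros es" by (simp add: common_zeros_def \<tau>_def)
    moreover have "x = enc \<tau>"
    proof (rule PiE_ext)
      show "x \<in> {1..n} \<rightarrow>\<^sub>E UNIV" using x by (simp add: int_solutions_def)
      show "enc \<tau> \<in> {1..n} \<rightarrow>\<^sub>E UNIV" by (simp add: enc_def)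
      show "x i = enc \<tau> i" if "i \<in> {1..n}" for i
        using val[OF inv_in(1)[OF that]] inv_in(2)[OF that] that by (simp add: enc_def)
    qed
    ultimately show ?thesis by blast
  qed
  have "finite (int_solutions n S)"
    by (rule finite_subset[OF _ finite_imageI[OF fin]]) (use sol_enc in blast)
  have vA: "Var v \<in> A" using v VA by blast
  then have "n \<ge> 1" using \<iota>_in[of "Var v"] by simp
  then have "\<bar>enc \<sigma> (\<iota> (Var v))\<bar> \<le> 2 ^ (2 ^ (n - 1))"
    using T \<open>S \<subseteq> E n\<close> \<open>finite (int_solutions n S)\<close> enc_sol[OF \<sigma>] \<iota>_in[OF vA]
    unfolding conjecture_T_def by blast
  also have "enc \<sigma> (\<iota> (Var v)) = \<sigma> v" using enc[OF vA] by simp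
  also have "(2 :: int) ^ (2 ^ (n - 1)) \<le> 2 ^ (2 ^ sum_list (map nodes es))"
    using card_UN_subexprs_le[of es] by (simp add: n_def A_def)
  finally show ?thesis .
qed

section \<open>Computable functions of one argument\<close>

definition unary_computable :: "(nat \<Rightarrow> nat) \<Rightarrow> bool" where
  "unary_computable F \<longleftrightarrow> (\<exists>f. \<forall>x. evaluates f [x] (F x))"

lemma evaluates_Comp1: "evaluates g xs y \<Longrightarrow> evaluates f [y] z \<Longrightarrow> evaluates (Comp f [g]) xs z"
  by (rule evaluates.Comp[where ys = "[y]"]) simp_all

lemma unary_computable_id: "unary_computable (\<lambda>x. x)"
  unfolding unary_computable_def using evaluates.Proj[of 0 "[x]" for x]
  by (intro exI[of _ "Proj 0"]) simp

lemma unary_computable_Suc: "unary_computable Suc"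
  unfolding unary_computable_def using evaluates.Succ by blast

lemma unary_computable_compose:
  "unary_computable F \<Longrightarrow> unary_computable G \<Longrightarrow> unary_computable (\<lambda>x. F (G x))"
  unfolding unary_computable_def using evaluates_Comp1 by metis

lemma unary_computable_funpow: "unary_computable F \<Longrightarrow> unary_computable (F ^^ n)"
  by (induction n) (auto simp: comp_def id_def intro: unary_computable_id unary_computable_compose)

text \<open>Primitive recursion without parameters: the base case is a constant, which has to be described as
a function of the empty argument list.\<close>

lemma unary_computable_iterate:
  assumes "unary_computable G"
  shows "unary_computable (\<lambda>n. (G ^^ n) a)"
proof -
  obtain g where g: "\<And>x. evaluates g [x] (G x)"
    using assms by (auto simp: unary_computable_def)
  have start: "\<exists>h. evaluates h [] a" for a
  proof (induction a)
    case 0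
    show ?case using evaluates.Zero by blast
  next
    case (Suc a)
    then show ?case using evaluates_Comp1 evaluates.Succ by blast
  qed
  then obtain h where h: "evaluates h [] a" by blast
  have "evaluates (PrimRec h (Comp g [Proj 1])) [n] ((G ^^ n) a)" for n
  proof (induction n)
    case 0
    then show ?case using evaluates.PrimRec_0[OF h] by simp
  next
    case (Suc n)
    have "evaluates (Comp g [Proj 1]) (n # (G ^^ n) a # []) (G ((G ^^ n) a))"
      using evaluates.Proj[of 1 "[n, (G ^^ n) a]"] g by (intro evaluates_Comp1) simp_all
    then show ?case using evaluates.PrimRec_Suc[OF Suc.IH] by simp
  qed
  then show ?thesis unfolding unary_computable_def by blast
qed

lemma unary_computable_double: "unary_computable (\<lambda>x. 2 * x)"
proof -
  have "((\<lambda>y. Suc (Suc y)) ^^ n) 0 = 2 * n" for n by (induction n) auto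
  then show ?thesis
    using unary_computable_iterate[of "\<lambda>y. Suc (Suc y)" 0]
    by (simp add: unary_computable_compose unary_computable_Suc)
qed

lemma unary_computable_exp2: "unary_computable (\<lambda>x. 2 ^ x)"
proof -
  have "((\<lambda>y. 2 * y) ^^ n) 1 = (2 :: nat) ^ n" for n by (induction n) auto
  then show ?thesis
    using unary_computable_iterate[OF unary_computable_double, of 1] by simp
qed

section \<open>The code bounds the parameters of a polynomial\<close>

lemma member_le_list_encode: "x \<in> set xs \<Longrightarrow> x \<le> list_encode xs"
proof (induction xs)
  case (Cons y xs)
  then show ?case
    using le_prod_encode_1[of y "list_encode xs"] le_prod_encode_2[of "list_encode xs" y] by fastforce
qed simp

lemma length_le_list_encode: "length xs \<le> list_encode xs"
proof (induction xs)
  case (Cons y xs)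
  then show ?case using le_prod_encode_2[of "list_encode xs" y] by simp
qed simp

lemma abs_le_int_encode: "nat \<bar>a\<bar> \<le> int_encode a"
  by (auto simp: int_encode_def sum_encode_def)

text \<open>The code dominates every quantity on which the size of the system depends, which is why a bound in
terms of the code alone suffices and no decoding is needed. The number of monomials and the degree
are bounded through the length \<open>(d + 1)\<^sup>p\<close> of the coefficient list, the degree because \<open>p \<ge> 1\<close>.\<close>

lemma parameters_le_poly_code:
  assumes "p \<ge> 1" "D \<in> polys p"
  shows "p \<le> poly_code p D"
    and "max_degree D \<le> poly_code p D"
    and "card (Poly_Mapping.keys D) \<le> poly_code p D"
    and "m \<in> Poly_Mapping.keys D \<Longrightarrow> nat \<bar>Poly_Mapping.lookup D m\<bar> \<le> poly_code p D"
proof -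
  let ?d = "max_degree D" and ?L = "map int_encode (coeff_list p D)"
  show "p \<le> poly_code p D" unfolding poly_code_def by (rule le_prod_encode_1)
  have L: "list_encode ?L \<le> poly_code p D" unfolding poly_code_def by (rule le_prod_encode_2)
  have "(?d + 1) ^ p = length ?L" by (simp add: coeff_list_def)
  also have "\<dots> \<le> poly_code p D" using length_le_list_encode L le_trans by blast
  finally have count: "(?d + 1) ^ p \<le> poly_code p D" .
  moreover have "?d + 1 \<le> (?d + 1) ^ p" using assms(1) by (intro self_le_power) auto
  ultimately show "?d \<le> poly_code p D" by simp
  have keys: "Poly_Mapping.keys D \<subseteq> nth_monomial p ?d ` {..<(?d + 1) ^ p}"
    using nth_monomial_surj[OF assms(2)] by blast
  have "card (Poly_Mapping.keys D) \<le> (?d + 1) ^ p"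
    using card_mono[OF _ keys] card_image_le[of "{..<(?d + 1) ^ p}" "nth_monomial p ?d"]
    by simp
  with count show "card (Poly_Mapping.keys D) \<le> poly_code p D" by simp
  show "nat \<bar>Poly_Mapping.lookup D m\<bar> \<le> poly_code p D" if m: "m \<in> Poly_Mapping.keys D"
  proof -
    have "int_encode (Poly_Mapping.lookup D m) \<in> set ?L"
      using m keys by (auto simp: coeff_list_def)
    then show ?thesis
      using member_le_list_encode L abs_le_int_encode le_trans by blast
  qed
qed

section \<open>Building blocks for expressions\<close>

definition sum_expr :: "'v expr list \<Rightarrow> 'v expr" where
  "sum_expr es = foldr Plus es (Minus Unit Unit)"

definition prod_expr :: "'v expr list \<Rightarrow> 'v expr" where
  "prod_expr es = foldr Times es Unit"

definition pow_expr :: "'v expr \<Rightarrow> nat \<Rightarrow> 'v expr" where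
  "pow_expr e k = prod_expr (replicate k e)"

text \<open>Integers are written in unary; one of the two sums is empty, since \<open>nat\<close> cuts off at \<open>0\<close>.\<close>

definition int_expr :: "int \<Rightarrow> 'v expr" where
  "int_expr a = Minus (sum_expr (replicate (nat a) Unit)) (sum_expr (replicate (nat (- a)) Unit))"

definition squares_expr :: "(nat \<Rightarrow> 'v) \<Rightarrow> 'v expr" where
  "squares_expr f = sum_expr (map (\<lambda>j. Times (Var (f j)) (Var (f j))) [0..<4])"

lemma expr_val_sum [simp]: "expr_val (sum_expr es) \<sigma> = (\<Sum>e\<leftarrow>es. expr_val e \<sigma>)"
  unfolding sum_expr_def by (induction es) auto

lemma expr_val_prod [simp]: "expr_val (prod_expr es) \<sigma> = (\<Prod>e\<leftarrow>es. expr_val e \<sigma>)"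
  unfolding prod_expr_def by (induction es) auto

lemma expr_val_pow [simp]: "expr_val (pow_expr e k) \<sigma> = expr_val e \<sigma> ^ k"
  by (simp add: pow_expr_def)

lemma expr_val_int [simp]: "expr_val (int_expr a) \<sigma> = a"
  by (simp add: int_expr_def sum_list_replicate)

lemma expr_val_squares [simp]: "expr_val (squares_expr f) \<sigma> = (\<Sum>j<4. (\<sigma> (f j))\<^sup>2)"
  by (simp add: squares_expr_def comp_def power2_eq_square interv_sum_list_conv_sum_set_nat
      atLeast0LessThan)

lemma nodes_sum_expr [simp]: "nodes (sum_expr es) = (\<Sum>e\<leftarrow>es. nodes e + 1) + 3"
  unfolding sum_expr_def by (induction es) auto

lemma nodes_prod_expr [simp]: "nodes (prod_expr es) = (\<Sum>e\<leftarrow>es. nodes e + 1) + 1"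
  unfolding prod_expr_def by (induction es) auto

lemma nodes_pow_expr [simp]: "nodes (pow_expr e k) = k * (nodes e + 1) + 1"
  by (simp add: pow_expr_def sum_list_replicate)

lemma nodes_int_expr [simp]: "nodes (int_expr a) = 2 * nat \<bar>a\<bar> + 7"
  by (simp add: int_expr_def sum_list_replicate)

lemma nodes_squares_expr [simp]: "nodes (squares_expr f) = 19"
  by (simp add: squares_expr_def comp_def sum_list_triv)

lemma vars_sum_expr [simp]: "set_expr (sum_expr es) = vars es"
  unfolding sum_expr_def vars_def by (induction es) auto

lemma vars_prod_expr [simp]: "set_expr (prod_expr es) = vars es"
  unfolding prod_expr_def vars_def by (induction es) auto

lemma vars_pow_expr: "set_expr (pow_expr e k) \<subseteq> set_expr e"
  by (auto simp: pow_expr_def vars_def)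

lemma vars_int_expr [simp]: "set_expr (int_expr a) = {}"
  by (auto simp: int_expr_def vars_def)

lemma vars_squares_expr [simp]: "set_expr (squares_expr f) = f ` {..<4}"
  by (auto simp: squares_expr_def vars_def)

section \<open>The integer system of a polynomial\<close>

text \<open>The integer unknowns that accompany the rational coordinate \<open>x\<^sub>i = y / z\<close>: \<open>Num i\<close> and \<open>Den i\<close> stand
for \<open>y\<close> and \<open>z\<close>, \<open>Root i j\<close> for four numbers whose squares add up to some \<open>s\<close>, \<open>Cofactor i\<close> for the
\<open>t\<close> in \<open>s y + t z = 1\<close>, and \<open>Gap i j\<close> for four numbers whose squares add up to \<open>z - 1 - s\<close>.\<close>

datatype coordinate = Num nat | Den nat | Cofactor nat | Root nat nat | Gap nat nat

text \<open>The vanishing of the next two expressions says \<open>s y + t z = 1\<close> and \<open>0 \<le> s < z\<close>. Together they force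
\<open>z > 0\<close> and coprimality. The range condition on \<open>s\<close> keeps the number of auxiliary values finite for
every \<open>y / z\<close>, which the Bezout identity alone would not.\<close>

definition coprime_expr :: "nat \<Rightarrow> coordinate expr" where
  "coprime_expr i =
     Minus (Plus (Times (squares_expr (Root i)) (Var (Num i)))
                 (Times (Var (Cofactor i)) (Var (Den i)))) Unit"

definition range_expr :: "nat \<Rightarrow> coordinate expr" where
  "range_expr i =
     Minus (Minus (Minus (Var (Den i)) Unit) (squares_expr (Root i))) (squares_expr (Gap i))"

text \<open>The polynomial \<open>D (y\<^sub>1 / z\<^sub>1, \<dots>, y\<^sub>p / z\<^sub>p)\<close> multiplied by \<open>(z\<^sub>1 \<cdots> z\<^sub>p)\<^sup>d\<close>, where \<open>d\<close> bounds the
degree in each variable.\<close>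

definition numerator_expr :: "nat \<Rightarrow> int_mpoly \<Rightarrow> coordinate expr" where
  "numerator_expr p D = sum_expr (map
     (\<lambda>m. Times (int_expr (Poly_Mapping.lookup D m)) (prod_expr (map
        (\<lambda>i. Times (pow_expr (Var (Num i)) (Poly_Mapping.lookup m i))
                    (pow_expr (Var (Den i)) (max_degree D - Poly_Mapping.lookup m i))) [1..<Suc p])))
     (sorted_list_of_set (Poly_Mapping.keys D)))"

definition zero_system :: "nat \<Rightarrow> int_mpoly \<Rightarrow> coordinate expr list" where
  "zero_system p D =
     numerator_expr p D # map coprime_expr [1..<Suc p] @ map range_expr [1..<Suc p]"

lemma lookup_le_max_degree:
  assumes "m \<in> Poly_Mapping.keys D"
  shows "Poly_Mapping.lookup m i \<le> max_degree D"
proof (cases "i \<in> Poly_Mapping.keys m")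
  case True
  then show ?thesis unfolding max_degree_def using assms by (intro Max_ge) auto
qed (simp add: in_keys_iff)

lemma prod_quotient_power:
  fixes y z :: "'i \<Rightarrow> rat" and e :: "'i \<Rightarrow> nat"
  assumes "finite I" "\<And>i. i \<in> I \<Longrightarrow> z i \<noteq> 0" "\<And>i. i \<in> I \<Longrightarrow> e i \<le> d"
  shows "(\<Prod>i\<in>I. (y i / z i) ^ e i) * (\<Prod>i\<in>I. z i ^ d) = (\<Prod>i\<in>I. y i ^ e i * z i ^ (d - e i))"
proof -
  have "(y i / z i) ^ e i * z i ^ d = y i ^ e i * z i ^ (d - e i)" if "i \<in> I" for i
    using assms(2,3)[OF that] by (simp add: power_divide power_diff)
  then show ?thesis by (simp flip: prod.distrib)
qed

lemma expr_val_numerator: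
  assumes D: "D \<in> polys p" and den: "\<And>i. i \<in> {1..p} \<Longrightarrow> \<sigma> (Den i) \<noteq> 0"
    and x: "\<And>i. i \<in> {1..p} \<Longrightarrow> x i = of_int (\<sigma> (Num i)) / of_int (\<sigma> (Den i))"
  shows "of_int (expr_val (numerator_expr p D) \<sigma>) =
    eval_mpoly D x * (\<Prod>i\<in>{1..p}. of_int (\<sigma> (Den i)) ^ max_degree D)"
proof -
  let ?d = "max_degree D" and ?I = "{1..p}"
  let ?y = "\<lambda>i. of_int (\<sigma> (Num i)) :: rat" and ?z = "\<lambda>i. of_int (\<sigma> (Den i)) :: rat"
  have monomial: "(\<Prod>i\<in>Poly_Mapping.keys m. x i ^ Poly_Mapping.lookup m i) * (\<Prod>i\<in>?I. ?z i ^ ?d) =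
      (\<Prod>i\<in>?I. ?y i ^ Poly_Mapping.lookup m i * ?z i ^ (?d - Poly_Mapping.lookup m i))"
    if m: "m \<in> Poly_Mapping.keys D" for m
  proof -
    have "Poly_Mapping.keys m \<subseteq> ?I" using D m by (auto simp: polys_def)
    then have "(\<Prod>i\<in>Poly_Mapping.keys m. x i ^ Poly_Mapping.lookup m i) =
        (\<Prod>i\<in>?I. x i ^ Poly_Mapping.lookup m i)"
      by (intro prod.mono_neutral_left) (auto simp: in_keys_iff)
    also have "\<dots> = (\<Prod>i\<in>?I. (?y i / ?z i) ^ Poly_Mapping.lookup m i)" using x by simp
    finally show ?thesis
      using prod_quotient_power[of ?I ?z "Poly_Mapping.lookup m" ?d ?y] den
        lookup_le_max_degree[OF m] by simp
  qed
  have "of_int (expr_val (numerator_expr p D) \<sigma>) =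
      (\<Sum>m\<in>Poly_Mapping.keys D. of_int (Poly_Mapping.lookup D m) *
        (\<Prod>i\<in>?I. ?y i ^ Poly_Mapping.lookup m i * ?z i ^ (?d - Poly_Mapping.lookup m i)))"
    by (simp add: numerator_expr_def comp_def sum_list_distinct_conv_sum_set
        prod.distinct_set_conv_list[symmetric] atLeastLessThanSuc_atLeastAtMost del: upt_Suc)
  also have "\<dots> = (\<Sum>m\<in>Poly_Mapping.keys D. of_int (Poly_Mapping.lookup D m) *
      ((\<Prod>i\<in>Poly_Mapping.keys m. x i ^ Poly_Mapping.lookup m i) * (\<Prod>i\<in>?I. ?z i ^ ?d)))"
    using monomial by simp
  finally show ?thesis by (simp add: eval_mpoly_def sum_distrib_right mult.assoc)
qed

lemma vars_zero_system_subset: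
  "vars (zero_system p D) \<subseteq> (\<Union>i\<in>{1..p}.
     {Num i, Den i, Cofactor i} \<union> Root i ` {..<4} \<union> Gap i ` {..<4})"
  using vars_pow_expr
  by (fastforce simp: vars_def zero_system_def numerator_expr_def coprime_expr_def range_expr_def)

lemma vars_zero_system_superset:
  assumes "i \<in> {1..p}"
  shows "Num i \<in> vars (zero_system p D)" "Den i \<in> vars (zero_system p D)"
  using assms by (auto simp: vars_def zero_system_def coprime_expr_def)

text \<open>Counting gives a cubic bound: at most \<open>c\<close> monomials, each a product of at most \<open>c\<close> pairs of powers
with exponents adding up to at most \<open>c\<close>, and \<open>70\<close> nodes per coordinate for the lowest terms. The
bound is rounded up to a shape convenient for the final estimate.\<close>

lemma nodes_zero_system:
  assumes "p \<le> c" "max_degree D \<le> c" "card (Poly_Mapping.keys D) \<le> c"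
    and "\<And>m. m \<in> Poly_Mapping.keys D \<Longrightarrow> nat \<bar>Poly_Mapping.lookup D m\<bar> \<le> c"
  shows "sum_list (map nodes (zero_system p D)) \<le> (c + 8) ^ 4"
proof -
  let ?K = "sorted_list_of_set (Poly_Mapping.keys D)"
  let ?f = "\<lambda>m i. Times (pow_expr (Var (Num i)) (Poly_Mapping.lookup m i))
                    (pow_expr (Var (Den i)) (max_degree D - Poly_Mapping.lookup m i))"
  let ?t = "\<lambda>m. Times (int_expr (Poly_Mapping.lookup D m)) (prod_expr (map (?f m) [1..<Suc p]))"
  have "nodes (?t m) + 1 \<le> 2 * c + c * (2 * c + 4) + 10" if "m \<in> set ?K" for m
  proof -
    have m: "m \<in> Poly_Mapping.keys D" using that by simp
    have "(\<Sum>i\<leftarrow>[1..<Suc p]. nodes (?f m i) + 1) = (\<Sum>i\<leftarrow>[1..<Suc p]. 2 * max_degree D + 4)"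
      using lookup_le_max_degree[OF m] by (intro arg_cong[of _ _ sum_list] map_cong)
        (auto simp: add.commute add.left_commute diff_mult_distrib2 simp flip: mult_2)
    then have factors: "(\<Sum>i\<leftarrow>[1..<Suc p]. nodes (?f m i) + 1) = p * (2 * max_degree D + 4)"
      by (simp add: sum_list_triv del: upt_Suc nodes.simps)
    have "nodes (?t m) + 1 = 2 * nat \<bar>Poly_Mapping.lookup D m\<bar> + p * (2 * max_degree D + 4) + 10"
      using factors by (simp add: comp_def del: upt_Suc)
    also have "\<dots> \<le> 2 * c + c * (2 * c + 4) + 10"
      using assms(1,2) assms(4)[OF m] by (intro add_mono mult_mono) auto
    finally show ?thesis .
  qed
  then have "(\<Sum>m\<leftarrow>?K. nodes (?t m) + 1) \<le> (\<Sum>m\<leftarrow>?K. 2 * c + c * (2 * c + 4) + 10)"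
    by (intro sum_list_mono)
  also have "\<dots> \<le> c * (2 * c + c * (2 * c + 4) + 10)"
    using assms(3) by (simp only: sum_list_triv length_sorted_list_of_set) (intro mult_right_mono, auto)
  finally have "nodes (numerator_expr p D) \<le> c * (2 * c + c * (2 * c + 4) + 10) + 3"
    by (simp add: numerator_expr_def comp_def del: upt_Suc)
  moreover have "sum_list (map nodes (zero_system p D)) = nodes (numerator_expr p D) + p * 70"
    by (simp add: zero_system_def comp_def coprime_expr_def range_expr_def sum_list_triv del: upt_Suc)
  moreover have "p * 70 \<le> c * 70" using assms(1) by simp
  moreover have "c * (2 * c + c * (2 * c + 4) + 10) + 3 + c * 70 \<le> (c + 8) ^ 4"
    by (simp add: power4_eq_xxxx algebra_simps)
  ultimately show ?thesis by linarith
qed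

section \<open>Fractions in lowest terms\<close>

lemma bezout_bounded:
  fixes y z :: int
  assumes "coprime y z" "z > 0"
  obtains s t where "s * y + t * z = 1" "0 \<le> s" "s < z"
proof -
  obtain u v where uv: "u * y + v * z = 1"
    using bezout_int[of y z] assms(1) by auto
  define q where "q = u div z"
  have mod: "u mod z = u - z * q" by (simp add: q_def minus_mult_div_eq_mod)
  have "(u - z * q) * y + (v + q * y) * z = 1" using uv by (simp add: algebra_simps)
  moreover have "0 \<le> u - z * q" "u - z * q < z"
    using assms(2) unfolding mod[symmetric] by simp_all
  ultimately show ?thesis by (rule that)
qed

lemma lowest_terms_witness:
  fixes y z :: int
  assumes "coprime y z" "z > 0"
  shows "\<exists>r g t. (\<Sum>j<(4::nat). (r j)\<^sup>2) * y + t * z = 1 \<and>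
    z - 1 - (\<Sum>j<(4::nat). (r j)\<^sup>2) - (\<Sum>j<(4::nat). (g j)\<^sup>2) = 0"
proof -
  have sum4: "\<exists>r. n = (\<Sum>j<(4::nat). (r j)\<^sup>2)" if "n \<ge> 0" for n :: int
  proof -
    obtain a b c d where "n = a\<^sup>2 + b\<^sup>2 + c\<^sup>2 + d\<^sup>2" using \<open>n \<ge> 0\<close> by (rule lagrange_four_squares)
    then show ?thesis
      by (intro exI[of _ "\<lambda>j. [a, b, c, d] ! j"]) (simp add: numeral_eq_Suc)
  qed
  obtain s t where st: "s * y + t * z = 1" "0 \<le> s" "s < z" using assms by (rule bezout_bounded)
  obtain r where r: "s = (\<Sum>j<(4::nat). (r j)\<^sup>2)" using sum4 st(2) by blast
  obtain g where g: "z - 1 - s = (\<Sum>j<(4::nat). (g j)\<^sup>2)" using sum4[of "z - 1 - s"] st(3) by auto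
  show ?thesis using st(1) r g by (intro exI[of _ r] exI[of _ g] exI[of _ t]) simp
qed

lemma height_quotient:
  assumes "coprime y z" "z > 0"
  shows "height (of_int y / of_int z) = max \<bar>y\<bar> z"
proof -
  have "quotient_of (of_int y / of_int z) = (y, z)"
    using assms by (simp add: Fract_of_int_quotient[symmetric] quotient_of_Fract normalize_stable)
  then show ?thesis by (simp add: height_def)
qed

text \<open>Why the encoding has finite fibres: \<open>s\<close> and its complement are smaller than \<open>z\<close>, hence so are the
squares of the eight numbers, and \<open>t\<close> is at most \<open>\<bar>t z\<bar> = \<bar>1 - s y\<bar>\<close> because \<open>z \<ge> 1\<close>.\<close>

lemma lowest_terms_bounds:
  fixes \<sigma> :: "coordinate \<Rightarrow> int"
  assumes "expr_val (coprime_expr i) \<sigma> = 0" "expr_val (range_expr i) \<sigma> = 0"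
  defines "y \<equiv> \<sigma> (Num i)" and "z \<equiv> \<sigma> (Den i)"
  shows "coprime y z" "z > 0"
    and "max \<bar>y\<bar> z \<le> h \<Longrightarrow> \<bar>\<sigma> (Cofactor i)\<bar> \<le> h * h + 1"
    and "max \<bar>y\<bar> z \<le> h \<Longrightarrow> j < 4 \<Longrightarrow> \<bar>\<sigma> (Root i j)\<bar> \<le> h * h + 1"
    and "max \<bar>y\<bar> z \<le> h \<Longrightarrow> j < 4 \<Longrightarrow> \<bar>\<sigma> (Gap i j)\<bar> \<le> h * h + 1"
    and "max \<bar>y\<bar> z \<le> h \<Longrightarrow> \<bar>y\<bar> \<le> h * h + 1"
    and "max \<bar>y\<bar> z \<le> h \<Longrightarrow> \<bar>z\<bar> \<le> h * h + 1"
proof -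
  define s where "s = (\<Sum>j<4. (\<sigma> (Root i j))\<^sup>2)"
  define w where "w = (\<Sum>j<4. (\<sigma> (Gap i j))\<^sup>2)"
  define t where "t = \<sigma> (Cofactor i)"
  have bezout: "s * y + t * z = 1" and range: "z = 1 + s + w"
    using assms(1,2) unfolding s_def w_def t_def y_def z_def coprime_expr_def range_expr_def by simp_all
  have s: "s \<ge> 0" and w: "w \<ge> 0" unfolding s_def w_def by (simp_all add: sum_nonneg)
  show z: "z > 0" using range s w by simp
  show "coprime y z" using bezout by (metis coprimeI dvd_add dvd_mult)
  assume "max \<bar>y\<bar> z \<le> h"
  then have y_le: "\<bar>y\<bar> \<le> h" and z_le: "z \<le> h" by simp_all
  have "h * 1 \<le> h * h" using z z_le by (intro mult_left_mono) simp_all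
  then have h: "h \<le> h * h + 1" by linarith
  show "\<bar>y\<bar> \<le> h * h + 1" "\<bar>z\<bar> \<le> h * h + 1" using y_le z_le z h by simp_all
  have base_le_square: "\<bar>a\<bar> \<le> a\<^sup>2" for a :: int
    using self_le_power[of "\<bar>a\<bar>" 2] by (cases "a = 0") simp_all
  show "\<bar>\<sigma> (Root i j)\<bar> \<le> h * h + 1" if "j < 4"
  proof -
    have "(\<sigma> (Root i j))\<^sup>2 \<le> s" unfolding s_def using that by (intro member_le_sum) auto
    then show ?thesis using base_le_square[of "\<sigma> (Root i j)"] range w z_le h by linarith
  qed
  show "\<bar>\<sigma> (Gap i j)\<bar> \<le> h * h + 1" if "j < 4"
  proof -
    have "(\<sigma> (Gap i j))\<^sup>2 \<le> w" unfolding w_def using that by (intro member_le_sum) auto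
    then show ?thesis using base_le_square[of "\<sigma> (Gap i j)"] range s z_le h by linarith
  qed
  have "\<bar>t\<bar> * 1 \<le> \<bar>t\<bar> * z" using z by (intro mult_left_mono) simp_all
  then have "\<bar>t\<bar> \<le> \<bar>t * z\<bar>" using z by (simp add: abs_mult)
  also have "t * z = 1 - s * y" using bezout by simp
  also have "\<bar>1 - s * y\<bar> \<le> 1 + s * \<bar>y\<bar>" using s abs_triangle_ineq4[of 1 "s * y"] by (simp add: abs_mult)
  also have "s * \<bar>y\<bar> \<le> h * h" using y_le z_le range s w by (intro mult_mono) simp_all
  finally show "\<bar>\<sigma> (Cofactor i)\<bar> \<le> h * h + 1" unfolding t_def by simp
qed

section \<open>Integer zeros against rational zeros\<close>

definition point :: "nat \<Rightarrow> (coordinate \<Rightarrow> int) \<Rightarrow> nat \<Rightarrow> rat" where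
  "point p \<sigma> = (\<lambda>i\<in>{1..p}. of_int (\<sigma> (Num i)) / of_int (\<sigma> (Den i)))"

lemma zero_system_zeroD:
  assumes "\<sigma> \<in> common_zeros (zero_system p D)"
  shows "expr_val (numerator_expr p D) \<sigma> = 0"
    and "i \<in> {1..p} \<Longrightarrow> expr_val (coprime_expr i) \<sigma> = 0"
    and "i \<in> {1..p} \<Longrightarrow> expr_val (range_expr i) \<sigma> = 0"
  using assms unfolding common_zeros_def zero_system_def by (auto simp del: upt_Suc)

lemma point_in_rat_solutions:
  assumes D: "D \<in> polys p" and \<sigma>: "\<sigma> \<in> common_zeros (zero_system p D)"
  shows "point p \<sigma> \<in> rat_solutions p D"
proof -
  have den: "\<sigma> (Den i) > 0" if "i \<in> {1..p}" for i
    using lowest_terms_bounds(2) zero_system_zeroD(2,3)[OF \<sigma> that] .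
  have "eval_mpoly D (point p \<sigma>) * (\<Prod>i\<in>{1..p}. of_int (\<sigma> (Den i)) ^ max_degree D) = 0"
    using expr_val_numerator[OF D, of \<sigma> "point p \<sigma>"] den zero_system_zeroD(1)[OF \<sigma>]
    by (force simp: point_def)
  moreover have "(\<Prod>i\<in>{1..p}. of_int (\<sigma> (Den i)) ^ max_degree D) \<noteq> (0 :: rat)"
    using den by force
  ultimately have "eval_mpoly D (point p \<sigma>) = 0" unfolding mult_eq_0_iff by blast
  then show ?thesis by (simp add: rat_solutions_def point_def)
qed

lemma tuple_height_ge: "i \<in> {1..p} \<Longrightarrow> height (x i) \<le> tuple_height p x"
  unfolding tuple_height_def by (intro Max_ge) auto

text \<open>Each zero of the integer system lies over a rational zero of \<open>D\<close> whose height bounds all its entries.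
So finitely many rational zeros leave finitely many integer ones.\<close>

lemma finite_zero_system:
  assumes D: "D \<in> polys p" and fin: "finite (rat_solutions p D)"
  shows "finite (common_zeros (zero_system p D))"
proof -
  let ?V = "vars (zero_system p D)"
  define M where "M x = tuple_height p x * tuple_height p x + 1" for x
  have finV: "finite ?V" by (rule finite_subset[OF vars_zero_system_subset]) simp
  have "common_zeros (zero_system p D) \<subseteq> (\<Union>x\<in>rat_solutions p D. ?V \<rightarrow>\<^sub>E {- M x..M x})"
  proof
    fix \<sigma> assume \<sigma>: "\<sigma> \<in> common_zeros (zero_system p D)"
    let ?x = "point p \<sigma>"
    have "\<bar>\<sigma> v\<bar> \<le> M ?x" if v_in: "v \<in> ?V" for v
    proof -
      obtain i where i: "i \<in> {1..p}"
        and v: "v \<in> {Num i, Den i, Cofactor i} \<union> Root i ` {..<4} \<union> Gap i ` {..<4}"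
        using v_in vars_zero_system_subset[of p D] by blast
      note lowest = lowest_terms_bounds[OF zero_system_zeroD(2,3)[OF \<sigma> i]]
      have "height (?x i) = max \<bar>\<sigma> (Num i)\<bar> (\<sigma> (Den i))"
        using height_quotient[OF lowest(1,2)] i by (simp add: point_def)
      then have "max \<bar>\<sigma> (Num i)\<bar> (\<sigma> (Den i)) \<le> tuple_height p ?x"
        using tuple_height_ge[OF i, of ?x] by simp
      from lowest(3-7)[OF this] v show ?thesis unfolding M_def by blast
    qed
    then have "\<sigma> v \<in> {- M ?x..M ?x}" if "v \<in> ?V" for v
      using that by (force simp: abs_le_iff)
    then have "\<sigma> \<in> ?V \<rightarrow>\<^sub>E {- M ?x..M ?x}"
      using \<sigma> unfolding common_zeros_def by (simp add: PiE_iff)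
    then show "\<sigma> \<in> (\<Union>x\<in>rat_solutions p D. ?V \<rightarrow>\<^sub>E {- M x..M x})"
      using point_in_rat_solutions[OF D \<sigma>] by blast
  qed
  moreover have "finite (\<Union>x\<in>rat_solutions p D. ?V \<rightarrow>\<^sub>E {- M x..M x})"
    using fin finV by (intro finite_UN_I finite_PiE) simp_all
  ultimately show ?thesis by (rule finite_subset)
qed

text \<open>The converse direction: writing the coordinates in lowest terms and choosing the auxiliary numbers
coordinate by coordinate.\<close>

lemma rat_solution_lifts:
  assumes D: "D \<in> polys p" and x: "x \<in> rat_solutions p D"
  obtains \<sigma> where "\<sigma> \<in> common_zeros (zero_system p D)"
    and "\<And>i. i \<in> {1..p} \<Longrightarrow> quotient_of (x i) = (\<sigma> (Num i), \<sigma> (Den i))"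
proof -
  define y z where "y i = fst (quotient_of (x i))" and "z i = snd (quotient_of (x i))" for i
  have q: "quotient_of (x i) = (y i, z i)" for i by (simp add: y_def z_def)
  have z: "z i > 0" "coprime (y i) (z i)" for i
    using quotient_of_denom_pos[OF q] quotient_of_coprime[OF q] by simp_all
  have "\<forall>i. \<exists>w. case w of (r, g, t) \<Rightarrow> (\<Sum>j<(4::nat). (r j)\<^sup>2) * y i + t * z i = 1 \<and>
      z i - 1 - (\<Sum>j<(4::nat). (r j)\<^sup>2) - (\<Sum>j<(4::nat). (g j)\<^sup>2) = 0"
    using lowest_terms_witness z by simp
  then obtain w where w: "\<forall>i. case w i of (r, g, t) \<Rightarrow> (\<Sum>j<(4::nat). (r j)\<^sup>2) * y i + t * z i = 1 \<and>
      z i - 1 - (\<Sum>j<(4::nat). (r j)\<^sup>2) - (\<Sum>j<(4::nat). (g j)\<^sup>2) = 0"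
    by (elim choice[THEN exE])
  define \<tau> where "\<tau> v = (case v of Num i \<Rightarrow> y i | Den i \<Rightarrow> z i | Cofactor i \<Rightarrow> snd (snd (w i))
      | Root i j \<Rightarrow> fst (w i) j | Gap i j \<Rightarrow> fst (snd (w i)) j)" for v
  have lowest: "expr_val (coprime_expr i) \<tau> = 0" "expr_val (range_expr i) \<tau> = 0" for i
    using spec[OF w, of i] by (simp_all add: coprime_expr_def range_expr_def \<tau>_def case_prod_beta)
  have "of_int (expr_val (numerator_expr p D) \<tau>) =
      eval_mpoly D x * (\<Prod>i\<in>{1..p}. of_int (\<tau> (Den i)) ^ max_degree D)"
    using z(1) quotient_of_div[OF q] by (intro expr_val_numerator[OF D])
      (simp_all add: \<tau>_def less_imp_neq[symmetric])
  then have num: "expr_val (numerator_expr p D) \<tau> = 0" using x by (simp add: rat_solutions_def)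
  define \<sigma> where "\<sigma> = restrict \<tau> (vars (zero_system p D))"
  have "expr_val e \<sigma> = 0" if e: "e \<in> set (zero_system p D)" for e
  proof -
    have "expr_val e \<sigma> = expr_val e \<tau>"
      using e by (intro expr_val_cong) (auto simp: \<sigma>_def vars_def)
    also have "\<dots> = 0" using e num lowest by (auto simp: zero_system_def)
    finally show ?thesis .
  qed
  then have "\<sigma> \<in> common_zeros (zero_system p D)" by (simp add: common_zeros_def \<sigma>_def)
  moreover have "quotient_of (x i) = (\<sigma> (Num i), \<sigma> (Den i))" if "i \<in> {1..p}" for i
    using vars_zero_system_superset[OF that] q[of i] by (simp add: \<sigma>_def \<tau>_def)
  ultimately show ?thesis by (rule that)
qed

section \<open>The computable bound\<close>

text \<open>A system of at most \<open>N\<close> unknowns gives the bound \<open>2 ^ (2 ^ N)\<close>, and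
\<open>N \<le> (c + 8) ^ 4 \<le> 2 ^ (4 * (c + 8))\<close> for the code \<open>c\<close>. The last estimate turns the bound into a
composition of successor, doubling and powers of two.\<close>

theorem theorem5:
  assumes conjecture_T
  shows "\<exists>B :: nat \<Rightarrow> int_mpoly \<Rightarrow> nat. computable_on_polys B \<and>
    (\<forall>p \<ge> 1. \<forall>D \<in> polys p. finite (rat_solutions p D) \<longrightarrow>
       (\<forall>x \<in> rat_solutions p D. tuple_height p x \<le> int (B p D)))"
proof -
  define F :: "nat \<Rightarrow> nat" where "F c = 2 ^ (2 ^ (2 ^ (2 * (2 * (Suc ^^ 8) c))))" for c
  define B where "B p D = F (poly_code p D)" for p D
  have "unary_computable F"
    unfolding F_def
    by (intro unary_computable_compose[OF unary_computable_exp2]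
        unary_computable_compose[OF unary_computable_double]
        unary_computable_funpow unary_computable_Suc)
  then have "computable_on_polys B"
    unfolding computable_on_polys_def unary_computable_def B_def by blast
  moreover have "tuple_height p x \<le> int (B p D)"
    if p: "p \<ge> 1" and D: "D \<in> polys p" and fin: "finite (rat_solutions p D)"
      and x: "x \<in> rat_solutions p D" for p D x
  proof -
    define c where "c = poly_code p D"
    let ?N = "sum_list (map nodes (zero_system p D))"
    obtain \<sigma> where \<sigma>: "\<sigma> \<in> common_zeros (zero_system p D)"
      and q: "\<And>i. i \<in> {1..p} \<Longrightarrow> quotient_of (x i) = (\<sigma> (Num i), \<sigma> (Den i))"
      using rat_solution_lifts[OF D x] by blast
    have "?N \<le> (c + 8) ^ 4"
      unfolding c_def using parameters_le_poly_code[OF p D] by (intro nodes_zero_system)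
    also have "\<dots> \<le> (2 ^ (c + 8)) ^ 4" by (intro power_mono less_imp_le less_exp) simp
    also have "\<dots> = 2 ^ (2 * (2 * (Suc ^^ 8) c))"
      by (simp add: Suc_funpow mult.commute flip: power_mult)
    finally have "(2 :: nat) ^ (2 ^ ?N) \<le> F c" unfolding F_def by simp
    then have N: "(2 :: int) ^ (2 ^ ?N) \<le> int (B p D)"
      unfolding B_def c_def by (metis of_nat_le_iff of_nat_numeral of_nat_power)
    have "height (x i) \<le> int (B p D)" if i: "i \<in> {1..p}" for i
    proof -
      have "\<bar>\<sigma> v\<bar> \<le> int (B p D)" if "v \<in> vars (zero_system p D)" for v
        using conjecture_T_bounds_common_zeros[OF assms finite_zero_system[OF D fin] \<sigma> that] N
        by linarith
      from this[OF vars_zero_system_superset(1)[OF i]] this[OF vars_zero_system_superset(2)[OF i]]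
      show ?thesis using q[OF i] by (simp add: height_def)
    qed
    then show ?thesis using p by (simp add: tuple_height_def)
  qed
  ultimately show ?thesis by blast
qed

end
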